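(* Let $d,m\geqslant 1$, let $f_0,f_1,\ldots,f_m:\mathbb{R}^d\to\mathbb{R}^d$ be globally Lipschitz continuous, and let $f(y,u)=f_0(y)+\sum_{j=1}^m u_jf_j(y)$. Let $\overline{y}\in\mathbb{R}^d$ satisfy $f_0(\overline{y})=0$ and let $y^0\in\mathbb{R}^d$. Assume that the system $\dot y=f(y,u)$ is controllable in some time $T_0>0$ with local cost estimate around $\overline{y}$ (Assumption (A) in the context). Then there exist a time $T^*>0$ and constants $C>0$ and $\mu>0$, all depending on $T_0,y^0,\overline{y}$ (and not on $T$), such that for every $T>T^*$, every global minimizer $u_T\in L^2(0,T;\mathbb{R}^m)$ of $$J_T(u)=\int_0^T\|y(t)-\overline{y}\|^2\,\mathrm{d}t+\int_0^T\|u(t)\|^2\,\mathrm{d}t$$ (where $y$ solves $\dot y=f(y,u)$ in $(0,T)$, $y(0)=y^0$; there is no final cost) and the corresponding state $y_T$, solution to $\dot y_T=f(y_T,u_T)$ with $y_T(0)=y^0$, satisfy $$\|u_T\|_{L^2(0,T;\mathbb{R}^m)}\leqslant C\quad\text{and}\quad\|y_T(t)-\overline{y}\|\leqslant Ce^{-\mu t}\ \text{ for all }t\in[0,T].$$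
   Context: $\|\cdot\|$ is the Euclidean norm. For every $y^0\in\mathbb{R}^d$ and $u\in L^1(0,T;\mathbb{R}^m)$, the system $\dot y=f(y,u)$ on $(0,T)$ with $y(0)=y^0$ has a unique solution $y\in C^0([0,T];\mathbb{R}^d)$, understood through the integral formulation $y(t)=y^0+\int_0^tf(y(s),u(s))\,\mathrm{d}s$. Assumption (A) (controllability and cost estimate), for a time $T_0>0$ and the point $\overline{y}$: (i) for any $y^0,y^1\in\mathbb{R}^d$ there exists $u\in L^2(0,T_0;\mathbb{R}^m)$ such that the solution $y$ of $\dot y=f(y,u)$ on $(0,T_0)$ with $y(0)=y^0$ satisfies $y(T_0)=y^1$; (ii) there exist a radius $r>0$ and a constant $C(T_0)>0$ such that for all $y^0,y^1\in\{x\in\mathbb{R}^d:\|x-\overline{y}\|\leqslant r\}$, $$\inf\left\{\|u\|_{L^2(0,T_0;\mathbb{R}^m)}: y(0)=y^0,\ y(T_0)=\overline{y}\right\}\leqslant C(T_0)\|y^0-\overline{y}\|,$$ $$\inf\left\{\|u\|_{L^2(0,T_0;\mathbb{R}^m)}: y(0)=\overline{y},\ y(T_0)=y^1\right\}\leqslant C(T_0)\|y^1-\overline{y}\|,$$ where in each infimum $u$ ranges over controls in $L^2(0,T_0;\mathbb{R}^m)$ whose associated solution $y$ of $\dot y=f(y,u)$ has the indicated endpoint values. *)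

theory Defs
  imports "HOL-Analysis.Analysis"
begin

text \<open>
  The state space is \<open>real^'d\<close> and the control space is \<open>real^'m\<close>; \<open>F j\<close> is the vector field
  multiplied by the \<open>j\<close>-th control component, and \<open>f0\<close> is the drift.
\<close>

definition control_affine ::
    "(real^'d \<Rightarrow> real^'d) \<Rightarrow> ('m::finite \<Rightarrow> real^'d \<Rightarrow> real^'d) \<Rightarrow> real^'d \<Rightarrow> real^'m \<Rightarrow> real^'d"
  where "control_affine f0 F y u = f0 y + (\<Sum>j\<in>UNIV. (u $ j) *\<^sub>R F j y)"

text \<open>
  Elements of $L^2(0,T;\mathbb{R}^m)$ are represented by functions on the whole line, of which only
  the values on \<open>{0..T}\<close> matter; the endpoints are a null set.
\<close>

definition L2 :: "real \<Rightarrow> (real \<Rightarrow> real^'m) set"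
  where "L2 T = {u. set_borel_measurable lebesgue {0..T} u \<and>
                    set_integrable lebesgue {0..T} (\<lambda>t. (norm (u t))\<^sup>2)}"

definition L2_norm :: "real \<Rightarrow> (real \<Rightarrow> real^'m) \<Rightarrow> real"
  where "L2_norm T u = sqrt (LINT t:{0..T}|lebesgue. (norm (u t))\<^sup>2)"

text \<open>
  The integrability conjunct guards against the Bochner integral being \<open>0\<close> by convention. It holds
  automatically if \<open>u\<close> is integrable and \<open>f\<close> is control-affine with continuous vector fields.
\<close>

definition solves ::
    "(real^'d \<Rightarrow> real^'m \<Rightarrow> real^'d) \<Rightarrow> real \<Rightarrow> real^'d \<Rightarrow> (real \<Rightarrow> real^'m) \<Rightarrow> (real \<Rightarrow> real^'d) \<Rightarrow> bool"
  where "solves f T y0 u y \<longleftrightarrow>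
     continuous_on {0..T} y \<and>
     set_integrable lebesgue {0..T} (\<lambda>s. f (y s) (u s)) \<and>
     (\<forall>t\<in>{0..T}. y t = y0 + (LINT s:{0..t}|lebesgue. f (y s) (u s)))"

text \<open>
  A solution is unique on \<open>{0..T}\<close> but arbitrary elsewhere, hence \<open>SOME\<close> instead of \<open>THE\<close>.
\<close>

definition state ::
    "(real^'d \<Rightarrow> real^'m \<Rightarrow> real^'d) \<Rightarrow> real \<Rightarrow> real^'d \<Rightarrow> (real \<Rightarrow> real^'m) \<Rightarrow> real \<Rightarrow> real^'d"
  where "state f T y0 u = (SOME y. solves f T y0 u y)"

definition steering_controls ::
    "(real^'d \<Rightarrow> real^'m \<Rightarrow> real^'d) \<Rightarrow> real \<Rightarrow> real^'d \<Rightarrow> real^'d \<Rightarrow> (real \<Rightarrow> real^'m) set"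
  where "steering_controls f T y0 y1 = {u \<in> L2 T. \<exists>y. solves f T y0 u y \<and> y T = y1}"

text \<open>The infimum is taken in \<open>ereal\<close>, so that it is \<open>\<infinity>\<close> over an empty set of controls.\<close>

definition steering_cost ::
    "(real^'d \<Rightarrow> real^'m \<Rightarrow> real^'d) \<Rightarrow> real \<Rightarrow> real^'d \<Rightarrow> real^'d \<Rightarrow> ereal"
  where "steering_cost f T y0 y1 = (INF u\<in>steering_controls f T y0 y1. ereal (L2_norm T u))"

definition controllable_with_local_cost ::
    "(real^'d \<Rightarrow> real^'m \<Rightarrow> real^'d) \<Rightarrow> real \<Rightarrow> real^'d \<Rightarrow> bool"
  where "controllable_with_local_cost f T0 ybar \<longleftrightarrow>
     (\<forall>y0 y1. steering_controls f T0 y0 y1 \<noteq> {}) \<and>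
     (\<exists>r>0. \<exists>C>0. \<forall>y0\<in>cball ybar r. \<forall>y1\<in>cball ybar r.
        steering_cost f T0 y0 ybar \<le> ereal (C * norm (y0 - ybar)) \<and>
        steering_cost f T0 ybar y1 \<le> ereal (C * norm (y1 - ybar)))"

definition tracking_cost ::
    "(real^'d \<Rightarrow> real^'m \<Rightarrow> real^'d) \<Rightarrow> real^'d \<Rightarrow> real^'d \<Rightarrow> real \<Rightarrow> (real \<Rightarrow> real^'m) \<Rightarrow> real"
  where "tracking_cost f ybar y0 T u =
     (LINT t:{0..T}|lebesgue. (norm (state f T y0 u t - ybar))\<^sup>2) +
     (LINT t:{0..T}|lebesgue. (norm (u t))\<^sup>2)"

end

theory Submission
  imports Defs
begin

text \<open>
  Let \<open>g(s)\<close> be the cost of the minimizer \<open>(u, y)\<close> on \<open>[s,T]\<close>. Following \<open>u\<close> up to time \<open>s\<close>, then steering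
  to the steady state in time \<open>T0\<close> and resting there with zero control is an admissible competitor, since
  no final cost is paid. As steering is locally cheap, this yields \<open>g(s) \<le> B |y(s) - ybar|^2\<close> for
  \<open>s \<le> T - T0\<close>; far from \<open>ybar\<close> this holds because \<open>g\<close> is bounded independently of \<open>T\<close>. Some
  \<open>s\<close> in \<open>[a,a+1]\<close> satisfies \<open>|y(s) - ybar|^2 \<le> g(a) - g(a+1)\<close>, so
  \<open>g(a+1) \<le> B/(B+1) g(a)\<close> and \<open>g\<close> decays exponentially. A Gronwall estimate turns the decay of \<open>g\<close>
  into a pointwise one for \<open>y\<close>.
  Uniqueness of solutions suffices throughout: every competitor comes with an explicit trajectory.
\<close>

subsection \<open>A Gronwall inequality with integrable kernel\<close>

lemma absolutely_integrable_mult_continuous: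
  fixes k \<phi> :: "real \<Rightarrow> real"
  assumes "k absolutely_integrable_on {a..b}" "continuous_on {a..b} \<phi>"
  shows "(\<lambda>s. k s * \<phi> s) absolutely_integrable_on {a..b}"
proof -
  have "bounded (\<phi> ` {a..b})"
    by (rule compact_imp_bounded[OF compact_continuous_image[OF assms(2) compact_Icc]])
  then have "(\<lambda>s. \<phi> s * k s) absolutely_integrable_on {a..b}"
    by (intro absolutely_integrable_bounded_measurable_product_real assms
          continuous_imp_measurable_on_sets_lebesgue) auto
  then show ?thesis by (simp add: mult.commute)
qed

text \<open>With kernel mass at most \<open>1/2\<close> the integral term is at most half the
  maximum of \<open>\<phi>\<close>, so it can be absorbed at the maximum point and the maximum is at
  most \<open>2 * A\<close>. The conclusion bounds \<open>A\<close> plus the whole integral, not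
  just \<open>\<phi> b\<close>, because this quantity plays the role of \<open>A\<close> on the next
  piece.\<close>

lemma integral_kernel_le_half:
  fixes k \<phi> :: "real \<Rightarrow> real"
  assumes "a \<le> b" and k: "k absolutely_integrable_on {a..b}"
    and k0: "\<And>s. s \<in> {a..b} \<Longrightarrow> 0 \<le> k s"
    and cont: "continuous_on {a..b} \<phi>"
    and phi0: "\<And>s. s \<in> {a..b} \<Longrightarrow> 0 \<le> \<phi> s"
    and le: "\<And>t. t \<in> {a..b} \<Longrightarrow> \<phi> t \<le> A + integral {a..t} (\<lambda>s. k s * \<phi> s)"
    and half: "integral {a..b} k \<le> 1 / 2"
  shows "A + integral {a..b} (\<lambda>s. k s * \<phi> s) \<le> 2 * A"
proof -
  obtain p where p: "p \<in> {a..b}" and pmax: "\<And>s. s \<in> {a..b} \<Longrightarrow> \<phi> s \<le> \<phi> p"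
    using continuous_attains_sup[OF compact_Icc _ cont] \<open>a \<le> b\<close> by fastforce
  have ki: "k integrable_on {a..b}"
    using k absolutely_integrable_on_def by blast
  have kp: "(\<lambda>s. k s * \<phi> s) integrable_on {a..b}"
    using absolutely_integrable_mult_continuous[OF k cont] absolutely_integrable_on_def by blast
  have up: "integral {a..t} (\<lambda>s. k s * \<phi> s) \<le> \<phi> p / 2" if t: "t \<in> {a..b}" for t
  proof -
    have sub: "{a..t} \<subseteq> {a..b}" using t by auto
    have "integral {a..t} (\<lambda>s. k s * \<phi> s) \<le> integral {a..b} (\<lambda>s. k s * \<phi> s)"
      using sub k0 phi0 integrable_on_subinterval[OF kp sub] by (intro integral_subset_le kp) auto
    also have "\<dots> \<le> integral {a..b} (\<lambda>s. k s * \<phi> p)"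
      by (intro integral_le kp integrable_on_mult_left ki) (auto intro!: mult_left_mono simp: k0 pmax)
    also have "\<dots> = integral {a..b} k * \<phi> p" by simp
    also have "\<dots> \<le> 1 / 2 * \<phi> p" by (intro mult_right_mono half phi0 p)
    finally show ?thesis by simp
  qed
  have "\<phi> p \<le> A + \<phi> p / 2" using le[OF p] up[OF p] by simp
  then have "\<phi> p \<le> 2 * A" by simp
  moreover have "integral {a..b} (\<lambda>s. k s * \<phi> s) \<le> \<phi> p / 2" using up \<open>a \<le> b\<close> by simp
  ultimately show ?thesis by simp
qed

text \<open>
  The usual exponential constant would need the chain rule for absolutely continuous functions;
  splitting the interval into pieces of kernel mass at most \<open>1/2\<close> only needs the intermediate value theorem.
\<close>

lemma integral_kernel_le_power:
  fixes k \<phi> :: "real \<Rightarrow> real"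
  assumes "a \<le> b" and "k absolutely_integrable_on {a..b}"
    and "\<And>s. s \<in> {a..b} \<Longrightarrow> 0 \<le> k s"
    and "continuous_on {a..b} \<phi>"
    and "\<And>s. s \<in> {a..b} \<Longrightarrow> 0 \<le> \<phi> s"
    and "\<And>t. t \<in> {a..b} \<Longrightarrow> \<phi> t \<le> A + integral {a..t} (\<lambda>s. k s * \<phi> s)"
    and "integral {a..b} k \<le> real (Suc N) / 2"
  shows "A + integral {a..b} (\<lambda>s. k s * \<phi> s) \<le> 2 ^ Suc N * A"
  using assms
proof (induction N arbitrary: b)
  case 0
  then show ?case using integral_kernel_le_half[of a b k \<phi> A] by simp
next
  case (Suc N)
  note k = Suc.prems(2) and k0 = Suc.prems(3) and cont = Suc.prems(4) and phi0 = Suc.prems(5)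
    and le = Suc.prems(6)
  have A0: "0 \<le> A" using le[of a] phi0[of a] \<open>a \<le> b\<close> by simp
  have ki: "k integrable_on {a..b}"
    using k absolutely_integrable_on_def by blast
  have kp: "(\<lambda>s. k s * \<phi> s) integrable_on {a..b}"
    using absolutely_integrable_mult_continuous[OF k cont] absolutely_integrable_on_def by blast
  \<comment> \<open>The cut leaves mass at most \<open>Suc N / 2\<close> on the left, for the
    induction hypothesis, and at most \<open>1/2\<close> on the right. If the left bound already
    holds on all of \<open>{a..b}\<close>, then \<open>c = b\<close> and the right piece is
    degenerate.\<close>
  have "\<exists>c\<in>{a..b}. integral {a..c} k \<le> real (Suc N) / 2 \<and> integral {c..b} k \<le> 1 / 2"
  proof (cases "integral {a..b} k \<le> real (Suc N) / 2")
    case True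
    then show ?thesis using \<open>a \<le> b\<close> by (intro bexI[of _ b]) auto
  next
    case False
    obtain c where c: "a \<le> c" "c \<le> b" "integral {a..c} k = real (Suc N) / 2"
      using IVT'[of "\<lambda>x. integral {a..x} k" a "real (Suc N) / 2" b] False \<open>a \<le> b\<close>
        indefinite_integral_continuous_1[OF ki] by auto
    have "integral {a..c} k + integral {c..b} k = integral {a..b} k"
      using c by (intro Henstock_Kurzweil_Integration.integral_combine ki) auto
    then show ?thesis using c Suc.prems(7) by (intro bexI[of _ c]) (auto simp: field_simps)
  qed
  then obtain c where c: "a \<le> c" "c \<le> b" "integral {a..c} k \<le> real (Suc N) / 2"
    "integral {c..b} k \<le> 1 / 2" by auto
  define R where "R = A + integral {a..c} (\<lambda>s. k s * \<phi> s)"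
  have comb: "integral {a..c} (\<lambda>s. k s * \<phi> s) + integral {c..t} (\<lambda>s. k s * \<phi> s)
      = integral {a..t} (\<lambda>s. k s * \<phi> s)" if "t \<in> {c..b}" for t
    using that c
    by (intro Henstock_Kurzweil_Integration.integral_combine integrable_on_subinterval[OF kp]) auto
  have "R \<le> 2 ^ Suc N * A"
    unfolding R_def
  proof (rule Suc.IH)
    show "k absolutely_integrable_on {a..c}"
      using c by (intro absolutely_integrable_on_subinterval[OF k]) auto
    show "continuous_on {a..c} \<phi>" using c by (intro continuous_on_subset[OF cont]) auto
  qed (use c k0 phi0 le in auto)
  moreover have "R + integral {c..b} (\<lambda>s. k s * \<phi> s) \<le> 2 * R"
  proof (rule integral_kernel_le_half)
    show "k absolutely_integrable_on {c..b}"
      using c by (intro absolutely_integrable_on_subinterval[OF k]) auto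
    show "continuous_on {c..b} \<phi>" using c by (intro continuous_on_subset[OF cont]) auto
    show "\<phi> t \<le> R + integral {c..t} (\<lambda>s. k s * \<phi> s)" if "t \<in> {c..b}" for t
      using le[of t] comb[of t] that c unfolding R_def by simp
  qed (use c k0 phi0 in auto)
  ultimately show ?case using comb[of b] c unfolding R_def by simp
qed

lemma gronwall:
  fixes k \<phi> :: "real \<Rightarrow> real"
  assumes "a \<le> b" and "k absolutely_integrable_on {a..b}"
    and "\<And>s. s \<in> {a..b} \<Longrightarrow> 0 \<le> k s"
    and "continuous_on {a..b} \<phi>"
    and "\<And>s. s \<in> {a..b} \<Longrightarrow> 0 \<le> \<phi> s"
    and "\<And>t. t \<in> {a..b} \<Longrightarrow> \<phi> t \<le> A + integral {a..t} (\<lambda>s. k s * \<phi> s)"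
    and "integral {a..b} k \<le> real (Suc N) / 2"
  shows "\<phi> b \<le> 2 ^ Suc N * A"
  using integral_kernel_le_power[OF assms] assms(1) assms(6)[of b] by simp

subsection \<open>Square-integrable controls and solutions\<close>

lemma norm_le_half_power2: "norm x \<le> (1 + (norm x)\<^sup>2) / 2"
  using sum_squares_bound[of 1 "norm x"] by simp

text \<open>On a bounded interval square integrability implies integrability, by domination with
  \<open>norm_le_half_power2\<close>. Measurability thus becomes part of absolute integrability, and
  both conditions can be handled with the Henstock-Kurzweil integral.\<close>

lemma L2_iff:
  "u \<in> L2 T \<longleftrightarrow> u absolutely_integrable_on {0..T} \<and> (\<lambda>t. (norm (u t))\<^sup>2) absolutely_integrable_on {0..T}"
proof (intro iffI conjI)
  assume u: "u \<in> L2 T"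
  then show sq: "(\<lambda>t. (norm (u t))\<^sup>2) absolutely_integrable_on {0..T}"
    by (simp add: L2_def)
  have "(\<lambda>t. (1 + (norm (u t))\<^sup>2) / 2) integrable_on {0..T}"
    using sq set_lebesgue_integral_eq_integral(1)
    by (intro integrable_on_divide integrable_add) auto
  then show "u absolutely_integrable_on {0..T}"
  proof (rule measurable_bounded_by_integrable_imp_absolutely_integrable[rotated 2])
    show "u \<in> borel_measurable (lebesgue_on {0..T})"
      using u by (simp add: L2_def set_borel_measurable_def borel_measurable_restrict_space_iff)
  qed (use norm_le_half_power2 in auto)
next
  assume "u absolutely_integrable_on {0..T} \<and> (\<lambda>t. (norm (u t))\<^sup>2) absolutely_integrable_on {0..T}"
  then show "u \<in> L2 T"
    unfolding L2_def set_integrable_def set_borel_measurable_def by auto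
qed

lemma solves_iff:
  "solves f T y0 u y \<longleftrightarrow> continuous_on {0..T} y \<and>
     (\<lambda>s. f (y s) (u s)) absolutely_integrable_on {0..T} \<and>
     (\<forall>t\<in>{0..T}. y t = y0 + integral {0..t} (\<lambda>s. f (y s) (u s)))"
proof -
  have "(LINT s:{0..t}|lebesgue. f (y s) (u s)) = integral {0..t} (\<lambda>s. f (y s) (u s))"
    if "(\<lambda>s. f (y s) (u s)) absolutely_integrable_on {0..T}" "t \<in> {0..T}" for t
    using that by (intro set_lebesgue_integral_eq_integral absolutely_integrable_on_subinterval[OF that(1)]) auto
  then show ?thesis unfolding solves_def by auto
qed

lemma solves_start: "solves f T y0 u y \<Longrightarrow> 0 \<le> T \<Longrightarrow> y 0 = y0"
  unfolding solves_iff by force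

lemma solves_diff:
  assumes "solves f T y0 u y" "0 \<le> s" "s \<le> t" "t \<le> T"
  shows "y t = y s + integral {s..t} (\<lambda>r. f (y r) (u r))"
proof -
  have i: "(\<lambda>r. f (y r) (u r)) integrable_on {0..t}"
    using assms set_lebesgue_integral_eq_integral(1)[OF absolutely_integrable_on_subinterval, of "{0..T}" _ 0 t]
    unfolding solves_iff by auto
  have "integral {0..s} (\<lambda>r. f (y r) (u r)) + integral {s..t} (\<lambda>r. f (y r) (u r))
      = integral {0..t} (\<lambda>r. f (y r) (u r))"
    using assms i by (intro Henstock_Kurzweil_Integration.integral_combine) auto
  then show ?thesis using assms unfolding solves_iff by (auto simp: algebra_simps)
qed

lemma solves_mono:
  assumes "solves f T y0 u y" "a \<le> T"
  shows "solves f a y0 u y"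
  using assms absolutely_integrable_on_subinterval[of "{0..T}" _ 0 a] continuous_on_subset[of "{0..T}" y "{0..a}"]
  unfolding solves_iff by auto

lemma L2_mono: "u \<in> L2 T \<Longrightarrow> a \<le> T \<Longrightarrow> u \<in> L2 a"
  unfolding L2_iff by (auto intro: absolutely_integrable_on_subinterval)

lemma L2_norm_nonneg [simp]: "0 \<le> L2_norm T u"
  unfolding L2_norm_def set_lebesgue_integral_def by simp

lemma L2_norm_power2:
  assumes "u \<in> L2 T"
  shows "(L2_norm T u)\<^sup>2 = integral {0..T} (\<lambda>t. (norm (u t))\<^sup>2)"
proof -
  have "(L2_norm T u)\<^sup>2 = (LINT t:{0..T}|lebesgue. (norm (u t))\<^sup>2)"
    unfolding L2_norm_def by (simp add: set_lebesgue_integral_def)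
  also have "\<dots> = integral {0..T} (\<lambda>t. (norm (u t))\<^sup>2)"
    using assms by (intro set_lebesgue_integral_eq_integral) (simp add: L2_iff)
  finally show ?thesis .
qed

section \<open>Concatenation of controls and trajectories\<close>

definition glue :: "real \<Rightarrow> (real \<Rightarrow> 'a) \<Rightarrow> (real \<Rightarrow> 'a) \<Rightarrow> real \<Rightarrow> 'a"
  where "glue a p q t = (if t \<le> a then p t else q (t - a))"

lemma has_integral_glue:
  fixes p q :: "real \<Rightarrow> 'a::banach"
  assumes "0 \<le> a" "0 \<le> b" "(p has_integral I) {0..a}" "(q has_integral J) {0..b}"
  shows "(glue a p q has_integral I + J) {0..a+b}"
proof (rule has_integral_combine)
  show "(glue a p q has_integral I) {0..a}"
    using assms(3) by (rule has_integral_eq[rotated]) (simp add: glue_def)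
  have "((\<lambda>t. q (t - a)) has_integral J) {a..a+b}"
    using has_integral_shift_real_ivl[OF assms(4), of "-a"] by (simp add: algebra_simps)
  \<comment> \<open>At the junction \<open>t = a\<close> the concatenation takes the value of
    \<open>p\<close>; this single point does not affect the integral of the shifted
    \<open>q\<close>.\<close>
  then show "(glue a p q has_integral J) {a..a+b}"
    by (rule has_integral_spike_finite[of "{a}", rotated 2]) (auto simp: glue_def)
qed (use assms in auto)

lemma absolutely_integrable_glue:
  fixes p q :: "real \<Rightarrow> 'a::euclidean_space"
  assumes "0 \<le> a" "0 \<le> b" "p absolutely_integrable_on {0..a}" "q absolutely_integrable_on {0..b}"
  shows "glue a p q absolutely_integrable_on {0..a+b}"
proof -
  have "(\<lambda>t. norm (glue a p q t)) = glue a (\<lambda>t. norm (p t)) (\<lambda>t. norm (q t))"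
    by (auto simp: glue_def)
  then show ?thesis
    using assms has_integral_glue[OF assms(1,2)] unfolding absolutely_integrable_on_def
    by (metis integrable_integral has_integral_integrable)
qed

lemma L2_glue:
  assumes "0 \<le> a" "0 \<le> b" "u \<in> L2 a" "v \<in> L2 b"
  shows "glue a u v \<in> L2 (a + b)"
proof -
  have "(\<lambda>t. (norm (glue a u v t))\<^sup>2) = glue a (\<lambda>t. (norm (u t))\<^sup>2) (\<lambda>t. (norm (v t))\<^sup>2)"
    by (auto simp: glue_def)
  then show ?thesis using assms unfolding L2_iff by (simp add: absolutely_integrable_glue)
qed

text \<open>As \<open>f\<close> does not depend on time, delaying \<open>z\<close> gives a
  trajectory again, and the right-hand side along the glued pair is the concatenation of the two
  right-hand sides. Starting \<open>z\<close> at \<open>y a\<close> makes the state continuous at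
  the junction.\<close>

lemma solves_glue:
  assumes a: "0 \<le> a" and b: "0 \<le> b" and y: "solves f a y0 u y" and z: "solves f b (y a) v z"
  shows "solves f (a + b) y0 (glue a u v) (glue a y z)"
proof -
  let ?p = "\<lambda>s. f (y s) (u s)" and ?q = "\<lambda>s. f (z s) (v s)"
  have eq: "(\<lambda>s. f (glue a y z s) (glue a u v s)) = glue a ?p ?q"
    by (auto simp: glue_def)
  have "continuous_on ({0..a} \<union> {a..a+b}) (glue a y z)"
    unfolding glue_def
  proof (rule continuous_on_If)
    show "continuous_on {0..a} y" using y by (simp add: solves_iff)
    have "continuous_on {0..b} z" using z by (simp add: solves_iff)
    then show "continuous_on {a..a+b} (\<lambda>t. z (t - a))"
      by (rule continuous_on_compose2) (auto intro!: continuous_intros)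
  qed (use solves_start[OF z b] in auto)
  moreover have "{0..a} \<union> {a..a+b} = {0..a+b}" using a b by auto
  moreover have "glue a ?p ?q absolutely_integrable_on {0..a+b}"
    using y z a b by (intro absolutely_integrable_glue) (auto simp: solves_iff)
  moreover have "glue a y z t = y0 + integral {0..t} (glue a ?p ?q)" if t: "t \<in> {0..a+b}" for t
  proof (cases "t \<le> a")
    case True
    then have "integral {0..t} (glue a ?p ?q) = integral {0..t} ?p"
      by (intro integral_cong) (auto simp: glue_def)
    then show ?thesis using y True t by (simp add: solves_iff glue_def)
  next
    case False
    have "?p integrable_on {0..a}"
      using y set_lebesgue_integral_eq_integral(1) by (auto simp: solves_iff)
    moreover have "?q integrable_on {0..t-a}"
      using solves_mono[OF z, of "t - a"] t set_lebesgue_integral_eq_integral(1) by (auto simp: solves_iff)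
    ultimately have "(glue a ?p ?q has_integral integral {0..a} ?p + integral {0..t-a} ?q) {0..a+(t-a)}"
      using a False by (intro has_integral_glue integrable_integral) auto
    then have "integral {0..t} (glue a ?p ?q) = integral {0..a} ?p + integral {0..t-a} ?q"
      by (simp add: integral_unique)
    moreover have "y a = y0 + integral {0..a} ?p" using y a by (simp add: solves_iff)
    moreover have "z (t - a) = y a + integral {0..t-a} ?q" using z t False by (simp add: solves_iff)
    ultimately show ?thesis using False by (simp add: glue_def)
  qed
  ultimately show ?thesis unfolding solves_iff eq by simp
qed

section \<open>Controls on subintervals and the running cost\<close>

lemma norm_absolutely_integrable_L2:
  assumes "u \<in> L2 T" "0 \<le> s" "t \<le> T"
  shows "(\<lambda>r. norm (u r)) absolutely_integrable_on {s..t}"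
proof -
  have "u absolutely_integrable_on {s..t}"
    by (rule absolutely_integrable_on_subinterval[of "{0..T}"]) (use assms in \<open>auto simp: L2_iff\<close>)
  then show ?thesis using absolutely_integrable_norm by (fastforce simp: o_def)
qed

lemma norm_power2_integrable_L2:
  assumes "u \<in> L2 T" "0 \<le> s" "t \<le> T"
  shows "(\<lambda>r. (norm (u r))\<^sup>2) integrable_on {s..t}"
proof -
  have "(\<lambda>r. (norm (u r))\<^sup>2) integrable_on {0..T}"
    using assms by (auto simp: L2_iff intro: set_lebesgue_integral_eq_integral(1))
  then show ?thesis by (rule integrable_on_subinterval) (use assms in auto)
qed

text \<open>Young's inequality with the scale \<open>q\<close> of the \<open>L2\<close> norm replaces Cauchy--Schwarz.\<close>

lemma integral_norm_le_L2:
  fixes u :: "real \<Rightarrow> real^'m"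
  assumes u: "u \<in> L2 T" and st: "0 \<le> s" "s \<le> t" "t \<le> T" "t - s \<le> h" and q: "0 < q"
    and le: "integral {s..t} (\<lambda>r. (norm (u r))\<^sup>2) \<le> q\<^sup>2"
  shows "integral {s..t} (\<lambda>r. norm (u r)) \<le> (h + 1) / 2 * q"
proof -
  have sq: "(\<lambda>r. (norm (u r))\<^sup>2) integrable_on {s..t}"
    by (rule norm_power2_integrable_L2[OF u st(1,3)])
  have "norm x \<le> (q + (norm x)\<^sup>2 / q) / 2" for x :: "real^'m"
    using sum_squares_bound[of "norm x" q] q by (simp add: field_simps power2_eq_square)
  then have "integral {s..t} (\<lambda>r. norm (u r)) \<le> integral {s..t} (\<lambda>r. (q + (norm (u r))\<^sup>2 / q) / 2)"
    using sq set_lebesgue_integral_eq_integral(1)[OF norm_absolutely_integrable_L2[OF u st(1,3)]]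
    by (intro integral_le integrable_on_divide integrable_add) auto
  also have "\<dots> = (integral {s..t} (\<lambda>r. q) + integral {s..t} (\<lambda>r. (norm (u r))\<^sup>2 / q)) / 2"
    using sq by (subst integral_add[symmetric]) (auto intro: integrable_on_divide)
  also have "\<dots> = (q * (t - s) + integral {s..t} (\<lambda>r. (norm (u r))\<^sup>2) / q) / 2"
    using st by simp
  also have "\<dots> \<le> (q * h + q\<^sup>2 / q) / 2"
    using le q st by (intro divide_right_mono add_mono mult_left_mono) auto
  also have "\<dots> = (h + 1) / 2 * q" using q by (simp add: field_simps power2_eq_square)
  finally show ?thesis .
qed

text \<open>This is the integrand of the tracking functional along an explicitly given trajectory,
  which avoids the choice operator in \<open>state\<close>.\<close>

definition running_cost :: "real^'d \<Rightarrow> (real \<Rightarrow> real^'m) \<Rightarrow> (real \<Rightarrow> real^'d) \<Rightarrow> real \<Rightarrow> real"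
  where "running_cost ybar u y t = (norm (y t - ybar))\<^sup>2 + (norm (u t))\<^sup>2"

lemma running_cost_nonneg [simp]: "0 \<le> running_cost ybar u y t"
  by (simp add: running_cost_def)

lemma running_cost_steady [simp]: "running_cost ybar (\<lambda>_. 0) (\<lambda>_. ybar) = (\<lambda>_. 0)"
  by (auto simp: running_cost_def)

lemma running_cost_glue:
  "running_cost ybar (glue a u v) (glue a y z) = glue a (running_cost ybar u y) (running_cost ybar v z)"
  by (auto simp: running_cost_def glue_def)

lemma deviation_integrable:
  assumes "solves f T z0 u y" "0 \<le> s" "t \<le> T"
  shows "(\<lambda>r. (norm (y r - ybar))\<^sup>2) absolutely_integrable_on {s..t}"
  using assms unfolding solves_iff
  by (intro absolutely_integrable_continuous_real continuous_intros) (auto intro: continuous_on_subset)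

lemma running_cost_integrable:
  assumes "solves f T z0 u y" "u \<in> L2 T" "0 \<le> s" "t \<le> T"
  shows "running_cost ybar u y integrable_on {s..t}"
  unfolding running_cost_def using assms
  by (intro integrable_add set_lebesgue_integral_eq_integral(1)[OF deviation_integrable]
        norm_power2_integrable_L2)

lemma deviation_le_running_cost:
  assumes "solves f T z0 u y" "u \<in> L2 T" "0 \<le> s" "t \<le> T"
  shows "integral {s..t} (\<lambda>r. (norm (y r - ybar))\<^sup>2) \<le> integral {s..t} (running_cost ybar u y)"
  using assms by (intro integral_le running_cost_integrable
    set_lebesgue_integral_eq_integral(1)[OF deviation_integrable]) (auto simp: running_cost_def)

lemma control_le_running_cost:
  assumes "solves f T z0 u y" "u \<in> L2 T" "0 \<le> s" "t \<le> T"
  shows "integral {s..t} (\<lambda>r. (norm (u r))\<^sup>2) \<le> integral {s..t} (running_cost ybar u y)"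
  using assms by (intro integral_le running_cost_integrable norm_power2_integrable_L2)
    (auto simp: running_cost_def)

lemma L2_norm_le_tracking_cost: "(L2_norm T u)\<^sup>2 \<le> tracking_cost f ybar y0 T u"
  unfolding L2_norm_def tracking_cost_def by (simp add: set_lebesgue_integral_def)

lemma solves_zero_length: "solves f 0 y0 u (\<lambda>_. y0)"
  unfolding solves_iff using absolutely_integrable_on_null[of "0::real" 0] by auto

subsection \<open>Growth estimates\<close>

text \<open>Of the dynamics, the argument uses only these bounds and controllability. The Lipschitz
  constant in the state may grow affinely with \<open>norm u\<close>, as for control-affine systems,
  and the bound at \<open>ybar\<close> encodes that \<open>ybar\<close> is an equilibrium for zero
  control.\<close>

locale lipschitz_control_system =
  fixes f :: "real^'d \<Rightarrow> real^'m \<Rightarrow> real^'d" and ybar :: "real^'d" and L M :: real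
  assumes lipschitz: "norm (f y u - f z u) \<le> L * (1 + norm u) * norm (y - z)"
    and steady_bound: "norm (f ybar u) \<le> M * norm u"
    and L_nonneg: "0 \<le> L" and M_nonneg: "0 \<le> M"
begin

lemma norm_le: "norm (f y u) \<le> L * (1 + norm u) * norm (y - ybar) + M * norm u"
  using norm_triangle_ineq[of "f y u - f ybar u" "f ybar u"] lipschitz[of y u ybar] steady_bound[of u]
  by simp

lemma steady: "f ybar 0 = 0"
  using steady_bound[of 0] by simp

lemma solves_steady: "solves f b ybar (\<lambda>_. 0) (\<lambda>_. ybar)"
  unfolding solves_iff by (simp add: steady)

lemma kernel_integrable:
  assumes "u \<in> L2 T" "0 \<le> s" "t \<le> T"
  shows "(\<lambda>r. L * (1 + norm (u r))) absolutely_integrable_on {s..t}"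
  by (intro set_integrable_mult_right set_integral_add norm_absolutely_integrable_L2[OF assms]
        absolutely_integrable_continuous_real continuous_on_const)

text \<open>Gronwall with initial term \<open>0\<close>, applied to the distance of two
  trajectories. The power of two multiplies \<open>0\<close>, so any \<open>N\<close> that dominates
  the kernel mass will do.\<close>

lemma solves_unique:
  assumes u: "u \<in> L2 T" and y: "solves f T y0 u y" and z: "solves f T y0 u z" and t: "t \<in> {0..T}"
  shows "y t = z t"
proof -
  let ?k = "\<lambda>r. L * (1 + norm (u r))"
  have k: "?k absolutely_integrable_on {0..t}"
    using kernel_integrable[OF u] t by auto
  have cont: "continuous_on {0..t} (\<lambda>r. norm (y r - z r))"
    using y z t unfolding solves_iff
    by (intro continuous_intros) (auto intro: continuous_on_subset)
  have kp: "(\<lambda>r. ?k r * norm (y r - z r)) absolutely_integrable_on {0..t}"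
    by (rule absolutely_integrable_mult_continuous[OF k cont])
  define N where "N = nat \<lceil>2 * integral {0..t} ?k\<rceil>"
  have "norm (y t - z t) \<le> 2 ^ Suc N * 0"
  proof (rule gronwall[where k = ?k and \<phi> = "\<lambda>r. norm (y r - z r)" and a = 0])
    show "integral {0..t} ?k \<le> real (Suc N) / 2"
      using real_nat_ceiling_ge[of "2 * integral {0..t} ?k"] unfolding N_def by simp
    show "norm (y r - z r) \<le> 0 + integral {0..r} (\<lambda>r. ?k r * norm (y r - z r))" if r: "r \<in> {0..t}" for r
    proof -
      have i: "(\<lambda>s. f (y s) (u s)) integrable_on {0..r}" "(\<lambda>s. f (z s) (u s)) integrable_on {0..r}"
        using solves_mono[OF y, of r] solves_mono[OF z, of r] r t set_lebesgue_integral_eq_integral(1)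
        unfolding solves_iff by auto
      have "y r - z r = integral {0..r} (\<lambda>s. f (y s) (u s) - f (z s) (u s))"
        using y z r t i by (simp add: solves_iff integral_diff)
      moreover have "(\<lambda>r. ?k r * norm (y r - z r)) integrable_on {0..r}"
        using r by (intro set_lebesgue_integral_eq_integral(1) absolutely_integrable_on_subinterval[OF kp]) auto
      ultimately show ?thesis
        using integral_norm_bound_integral[OF integrable_diff[OF i], of "\<lambda>r. ?k r * norm (y r - z r)"]
          lipschitz by simp
    qed
  qed (use t k cont L_nonneg in auto)
  then show ?thesis by simp
qed

lemma state_eq:
  assumes "u \<in> L2 T" "solves f T y0 u y" "t \<in> {0..T}"
  shows "state f T y0 u t = y t"
  using assms solves_unique someI[of "solves f T y0 u" y] unfolding state_def by blast

lemma tracking_cost_eq: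
  assumes u: "u \<in> L2 T" and y: "solves f T y0 u y"
  shows "tracking_cost f ybar y0 T u = integral {0..T} (running_cost ybar u y)"
proof -
  have "(LINT t:{0..T}|lebesgue. (norm (state f T y0 u t - ybar))\<^sup>2)
      = (LINT t:{0..T}|lebesgue. (norm (y t - ybar))\<^sup>2)"
    using state_eq[OF u y] by (intro set_lebesgue_integral_cong) auto
  moreover have yi: "(\<lambda>t. (norm (y t - ybar))\<^sup>2) absolutely_integrable_on {0..T}"
    using deviation_integrable[OF y] by simp
  moreover have ui: "(\<lambda>t. (norm (u t))\<^sup>2) absolutely_integrable_on {0..T}"
    using u by (simp add: L2_iff)
  ultimately show ?thesis
    unfolding tracking_cost_def running_cost_def
    by (simp add: set_lebesgue_integral_eq_integral integral_add)
qed

text \<open>Gronwall for the distance to \<open>ybar\<close>. Besides \<open>L\<close> and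
  \<open>M\<close>, the factor \<open>G\<close> depends only on \<open>h\<close> and
  \<open>Q\<close>, not on \<open>T\<close> or the trajectory: \<open>Q\<close> caps the kernel mass
  and hence the number of doublings. The bound is linear in \<open>q\<close>, which later lets
  quadratic costs be compared with squared distances.\<close>

lemma deviation_bound:
  assumes h: "0 \<le> h"
  obtains G where "0 < G"
    "\<And>T u y z0 s t q. \<lbrakk>u \<in> L2 T; solves f T z0 u y; 0 \<le> s; s \<le> t; t \<le> T; t - s \<le> h;
       0 < q; q \<le> Q; integral {s..t} (\<lambda>r. (norm (u r))\<^sup>2) \<le> q\<^sup>2\<rbrakk>
       \<Longrightarrow> norm (y t - ybar) \<le> G * (norm (y s - ybar) + q)"
proof
  define N where "N = nat \<lceil>2 * (L * (h + (h + 1) / 2 * Q))\<rceil>"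
  define G where "G = 2 ^ Suc N * (1 + M * ((h + 1) / 2))"
  have Mh: "0 \<le> M * ((h + 1) / 2)" using M_nonneg h by simp
  show "0 < G" unfolding G_def using Mh by (intro mult_pos_pos) auto
  fix T u y z0 s t q
  assume u: "u \<in> L2 T" and y: "solves f T z0 u y" and st: "0 \<le> s" "s \<le> t" "t \<le> T" "t - s \<le> h"
    and q: "0 < q" "q \<le> Q" and le: "integral {s..t} (\<lambda>r. (norm (u r))\<^sup>2) \<le> q\<^sup>2"
  let ?k = "\<lambda>r. L * (1 + norm (u r))"
  have k: "?k absolutely_integrable_on {s..t}"
    using kernel_integrable[OF u] st by auto
  have cont: "continuous_on {s..t} (\<lambda>r. norm (y r - ybar))"
    using y st unfolding solves_iff
    by (intro continuous_intros) (auto intro: continuous_on_subset)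
  have kp: "(\<lambda>r. ?k r * norm (y r - ybar)) absolutely_integrable_on {s..t}"
    by (rule absolutely_integrable_mult_continuous[OF k cont])
  have un: "(\<lambda>r. norm (u r)) integrable_on {s..t}"
    using norm_absolutely_integrable_L2[OF u st(1,3)] set_lebesgue_integral_eq_integral(1) by blast
  have int_u: "integral {s..t} (\<lambda>r. norm (u r)) \<le> (h + 1) / 2 * q"
    by (rule integral_norm_le_L2[OF u st q(1) le])
  have "norm (y t - ybar) \<le> 2 ^ Suc N * (norm (y s - ybar) + M * ((h + 1) / 2 * q))"
  proof (rule gronwall[where k = ?k and \<phi> = "\<lambda>r. norm (y r - ybar)" and a = s])
    have "integral {s..t} ?k = L * ((t - s) + integral {s..t} (\<lambda>r. norm (u r)))"
      using integral_add[OF integrable_const_ivl[of 1] un] st by simp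
    also have "\<dots> \<le> L * (h + (h + 1) / 2 * Q)"
    proof -
      have "(h + 1) / 2 * q \<le> (h + 1) / 2 * Q" using q h by (intro mult_left_mono) auto
      then have "(t - s) + integral {s..t} (\<lambda>r. norm (u r)) \<le> h + (h + 1) / 2 * Q"
        using int_u st(4) by linarith
      then show ?thesis by (rule mult_left_mono[OF _ L_nonneg])
    qed
    also have "\<dots> \<le> real (Suc N) / 2"
      using real_nat_ceiling_ge[of "2 * (L * (h + (h + 1) / 2 * Q))"] unfolding N_def by simp
    finally show "integral {s..t} ?k \<le> real (Suc N) / 2" .
    show "norm (y r - ybar) \<le> norm (y s - ybar) + M * ((h + 1) / 2 * q)
        + integral {s..r} (\<lambda>r. ?k r * norm (y r - ybar))" if r: "r \<in> {s..t}" for r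
    proof -
      have i: "(\<lambda>x. f (y x) (u x)) integrable_on {s..r}"
        using y r st
        by (intro integrable_on_subinterval[OF set_lebesgue_integral_eq_integral(1), of "{0..T}"])
           (auto simp: solves_iff)
      have kp': "(\<lambda>r. ?k r * norm (y r - ybar)) integrable_on {s..r}"
        using r by (intro set_lebesgue_integral_eq_integral(1) absolutely_integrable_on_subinterval[OF kp]) auto
      have un': "(\<lambda>r. norm (u r)) integrable_on {s..r}"
        using r by (intro integrable_on_subinterval[OF un]) auto
      \<comment> \<open>By \<open>norm_le\<close> the right-hand side splits into a part
        proportional to the deviation, which feeds the Gronwall kernel, and a part bounded by the
        integral of \<open>norm u\<close>, which joins the constant term.\<close>
      have "norm (integral {s..r} (\<lambda>x. f (y x) (u x)))
          \<le> integral {s..r} (\<lambda>x. ?k x * norm (y x - ybar) + M * norm (u x))"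
        using norm_le by (intro integral_norm_bound_integral i integrable_add kp' integrable_on_mult_right un') auto
      also have "\<dots> = integral {s..r} (\<lambda>x. ?k x * norm (y x - ybar)) + M * integral {s..r} (\<lambda>x. norm (u x))"
        using kp' un' by (subst integral_add) (auto intro!: integrable_on_mult_right)
      also have "integral {s..r} (\<lambda>x. norm (u x)) \<le> integral {s..t} (\<lambda>x. norm (u x))"
        using r by (intro integral_subset_le un un') auto
      also note int_u
      finally have "norm (integral {s..r} (\<lambda>x. f (y x) (u x)))
        \<le> integral {s..r} (\<lambda>x. ?k x * norm (y x - ybar)) + M * ((h + 1) / 2 * q)"
        using M_nonneg by (auto simp: mult_left_mono)
      moreover have "norm (y r - ybar) \<le> norm (y s - ybar) + norm (integral {s..r} (\<lambda>x. f (y x) (u x)))"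
        using solves_diff[OF y, of s r] r st
          norm_triangle_ineq[of "y s - ybar" "integral {s..r} (\<lambda>x. f (y x) (u x))"]
        by (simp add: algebra_simps)
      ultimately show ?thesis by linarith
    qed
  qed (use st k cont L_nonneg in auto)
  also have "\<dots> \<le> G * (norm (y s - ybar) + q)"
  proof -
    have "x + c * q \<le> (1 + c) * (x + q)" if "0 \<le> c" "0 \<le> x" for c x
      using mult_nonneg_nonneg[OF that] that q by (simp add: algebra_simps)
    then have "norm (y s - ybar) + M * ((h + 1) / 2 * q)
        \<le> (1 + M * ((h + 1) / 2)) * (norm (y s - ybar) + q)"
      using Mh by (simp only: mult.assoc[symmetric] norm_ge_zero)
    then show ?thesis unfolding G_def by (simp add: mult.assoc mult_left_mono)
  qed
  finally show "norm (y t - ybar) \<le> G * (norm (y s - ybar) + q)" .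
qed

subsection \<open>Exponential decay of the cost-to-go\<close>

text \<open>The third phase, resting at \<open>ybar\<close> with zero control for the remaining
  time, is a trajectory by \<open>solves_steady\<close> and costs nothing, so only the first two
  phases are paid for.\<close>

lemma competitor:
  assumes u: "u \<in> L2 \<tau>" "solves f \<tau> y0 u y" "0 \<le> \<tau>"
    and v: "v \<in> L2 S" "solves f S (y \<tau>) v z" "z S = ybar" "0 \<le> S" and T: "\<tau> + S \<le> T"
  obtains w where "w \<in> L2 T" "tracking_cost f ybar y0 T w =
    integral {0..\<tau>} (running_cost ybar u y) + integral {0..S} (running_cost ybar v z)"
proof
  define b where "b = T - \<tau> - S"
  have b: "0 \<le> b" "T = \<tau> + (S + b)" using T unfolding b_def by auto
  define v' where "v' = glue S v (\<lambda>_. 0)"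
  define z' where "z' = glue S z (\<lambda>_. ybar)"
  have "(\<lambda>_. 0) \<in> L2 b" unfolding L2_iff by simp
  then have v': "v' \<in> L2 (S + b)" unfolding v'_def using v b by (intro L2_glue) auto
  have z': "solves f (S + b) (y \<tau>) v' z'"
    unfolding v'_def z'_def using v b solves_steady by (intro solves_glue) auto
  show w: "glue \<tau> u v' \<in> L2 T" unfolding b(2) using u v b v' by (intro L2_glue) auto
  have y: "solves f T y0 (glue \<tau> u v') (glue \<tau> y z')"
    unfolding b(2) using u v b z' by (intro solves_glue) auto
  let ?I = "integral {0..S} (running_cost ybar v z)"
  have "(running_cost ybar v' z' has_integral (?I + 0)) {0..S+b}"
    unfolding v'_def z'_def running_cost_glue using v b
    by (intro has_integral_glue integrable_integral running_cost_integrable) auto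
  then have "(running_cost ybar (glue \<tau> u v') (glue \<tau> y z') has_integral
      (integral {0..\<tau>} (running_cost ybar u y) + (?I + 0))) {0..\<tau>+(S+b)}"
    unfolding running_cost_glue using u v b
    by (intro has_integral_glue integrable_integral running_cost_integrable) auto
  then show "tracking_cost f ybar y0 T (glue \<tau> u v') =
      integral {0..\<tau>} (running_cost ybar u y) + ?I"
    using tracking_cost_eq[OF w y] b(2) by (simp add: integral_unique)
qed

text \<open>A Bellman-type comparison: the minimizer and the competitor share the cost on
  \<open>{0..\<tau>}\<close>, which cancels. The assumption \<open>\<tau> + S \<le> T\<close> leaves
  enough time for steering.\<close>

lemma minimizer_tail_le:
  assumes min: "is_arg_min (tracking_cost f ybar y0 T) (\<lambda>v. v \<in> L2 T) u"
    and y: "solves f T y0 u y" and \<tau>: "0 \<le> \<tau>" "\<tau> + S \<le> T"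
    and v: "v \<in> L2 S" "solves f S (y \<tau>) v z" "z S = ybar" "0 \<le> S"
  shows "integral {\<tau>..T} (running_cost ybar u y) \<le> integral {0..S} (running_cost ybar v z)"
proof -
  have u: "u \<in> L2 T" and le: "\<And>w. w \<in> L2 T \<Longrightarrow> tracking_cost f ybar y0 T u \<le> tracking_cost f ybar y0 T w"
    using min by (auto simp: is_arg_min_def not_less)
  have \<tau>T: "\<tau> \<le> T" using \<tau> v by simp
  obtain w where w: "w \<in> L2 T" "tracking_cost f ybar y0 T w =
      integral {0..\<tau>} (running_cost ybar u y) + integral {0..S} (running_cost ybar v z)"
    using competitor[OF L2_mono[OF u \<tau>T] solves_mono[OF y \<tau>T] \<tau>(1) v \<tau>(2)] .
  have "integral {0..\<tau>} (running_cost ybar u y) + integral {\<tau>..T} (running_cost ybar u y)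
      = tracking_cost f ybar y0 T u"
    unfolding tracking_cost_eq[OF u y] using \<tau> \<tau>T running_cost_integrable[OF y u]
    by (intro Henstock_Kurzweil_Integration.integral_combine) auto
  then show ?thesis using le[OF w(1)] w(2) by simp
qed

text \<open>The infimum in the cost estimate need not be attained, so the constant is doubled to
  select a control. Its norm is then at most proportional to the distance of \<open>p\<close> from
  \<open>ybar\<close>, and by \<open>deviation_bound\<close> so is the deviation along the
  trajectory; squaring and integrating gives a quadratic cost.\<close>

lemma local_steering:
  assumes S: "0 < S" and ctrl: "controllable_with_local_cost f S ybar"
  obtains r K where "0 < r" "0 < K"
    "\<And>p. norm (p - ybar) \<le> r \<Longrightarrow> \<exists>v z. v \<in> L2 S \<and> solves f S p v z \<and> z S = ybar \<and>
       integral {0..S} (running_cost ybar v z) \<le> K * (norm (p - ybar))\<^sup>2"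
proof -
  obtain r C where r: "0 < r" and C: "0 < C"
    and cost: "\<And>p. p \<in> cball ybar r \<Longrightarrow> steering_cost f S p ybar \<le> ereal (C * norm (p - ybar))"
    using ctrl unfolding controllable_with_local_cost_def by blast
  obtain G where G: "0 < G" and bound: "\<And>T u y z0 s t q. \<lbrakk>u \<in> L2 T; solves f T z0 u y; 0 \<le> s; s \<le> t; t \<le> T; t - s \<le> S;
       0 < q; q \<le> 2 * C * r; integral {s..t} (\<lambda>r. (norm (u r))\<^sup>2) \<le> q\<^sup>2\<rbrakk>
       \<Longrightarrow> norm (y t - ybar) \<le> G * (norm (y s - ybar) + q)"
    using deviation_bound[of S "2 * C * r"] S by auto
  define K where "K = S * (G * (1 + 2 * C))\<^sup>2 + (2 * C)\<^sup>2"
  have K: "0 < K" unfolding K_def using S C by (intro add_nonneg_pos) auto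
  have "\<exists>v z. v \<in> L2 S \<and> solves f S p v z \<and> z S = ybar \<and>
       integral {0..S} (running_cost ybar v z) \<le> K * (norm (p - ybar))\<^sup>2" if p: "norm (p - ybar) \<le> r" for p
  proof (cases "p = ybar")
    \<comment> \<open>At \<open>p = ybar\<close> the doubled bound would be \<open>0\<close> and no
      strict inequality could hold; here resting with zero control costs nothing.\<close>
    case True
    have "(\<lambda>_. 0) \<in> L2 S" unfolding L2_iff by simp
    then show ?thesis using True solves_steady[of S]
      by (intro exI[of _ "\<lambda>_. 0"] exI[of _ "\<lambda>_. ybar"]) auto
  next
    case False
    define \<rho> where "\<rho> = norm (p - ybar)"
    have \<rho>: "0 < \<rho>" "\<rho> \<le> r" using False p by (auto simp: \<rho>_def)
    have "steering_cost f S p ybar < ereal (2 * C * \<rho>)"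
    proof (rule le_less_trans)
      show "steering_cost f S p ybar \<le> ereal (C * \<rho>)"
        using cost[of p] p by (simp add: \<rho>_def dist_norm norm_minus_commute)
    qed (use \<rho> C in simp)
    then obtain v z where v: "v \<in> L2 S" and z: "solves f S p v z" "z S = ybar"
      and norm_v: "L2_norm S v < 2 * C * \<rho>"
      unfolding steering_cost_def INF_less_iff steering_controls_def by auto
    have int_v: "integral {0..S} (\<lambda>t. (norm (v t))\<^sup>2) \<le> (2 * C * \<rho>)\<^sup>2"
      unfolding L2_norm_power2[OF v, symmetric] using norm_v by (intro power_mono) auto
    have dev: "(norm (z t - ybar))\<^sup>2 \<le> (G * (1 + 2 * C))\<^sup>2 * \<rho>\<^sup>2" if t: "t \<in> {0..S}" for t
    proof -
      have "integral {0..t} (\<lambda>t. (norm (v t))\<^sup>2) \<le> integral {0..S} (\<lambda>t. (norm (v t))\<^sup>2)"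
        using t by (intro integral_subset_le norm_power2_integrable_L2[OF v]) auto
      then have "norm (z t - ybar) \<le> G * (norm (z 0 - ybar) + 2 * C * \<rho>)"
        using int_v t \<rho> C by (intro bound[OF v z(1)]) auto
      also have "\<dots> = G * (1 + 2 * C) * \<rho>"
        using solves_start[OF z(1)] S by (simp add: \<rho>_def algebra_simps)
      finally show ?thesis
        using power_mono[of "norm (z t - ybar)" "G * (1 + 2 * C) * \<rho>" 2] by (simp add: power_mult_distrib)
    qed
    have zi: "(\<lambda>t. (norm (z t - ybar))\<^sup>2) integrable_on {0..S}"
      using deviation_integrable[OF z(1)] by (intro set_lebesgue_integral_eq_integral(1)) auto
    have "integral {0..S} (running_cost ybar v z)
        = integral {0..S} (\<lambda>t. (norm (z t - ybar))\<^sup>2) + integral {0..S} (\<lambda>t. (norm (v t))\<^sup>2)"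
      unfolding running_cost_def using zi norm_power2_integrable_L2[OF v] by (intro integral_add) auto
    also have "integral {0..S} (\<lambda>t. (norm (z t - ybar))\<^sup>2) \<le> integral {0..S} (\<lambda>t. (G * (1 + 2 * C))\<^sup>2 * \<rho>\<^sup>2)"
      using dev zi by (intro integral_le) auto
    also have "\<dots> = S * (G * (1 + 2 * C))\<^sup>2 * \<rho>\<^sup>2" using S by simp
    also note int_v
    finally have "integral {0..S} (running_cost ybar v z) \<le> K * \<rho>\<^sup>2"
      unfolding K_def by (simp add: algebra_simps power_mult_distrib)
    then show ?thesis using v z unfolding \<rho>_def by auto
  qed
  then show thesis using that r K by blast
qed

end

text \<open>The minimum over an interval is at most the mean value, which for unit length is the
  integral itself.\<close>

lemma exists_le_unit_integral:
  fixes \<phi> :: "real \<Rightarrow> real"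
  assumes "continuous_on {a..a+1} \<phi>"
  shows "\<exists>s\<in>{a..a+1}. \<phi> s \<le> integral {a..a+1} \<phi>"
proof -
  obtain s where s: "s \<in> {a..a+1}" "\<And>t. t \<in> {a..a+1} \<Longrightarrow> \<phi> s \<le> \<phi> t"
    using continuous_attains_inf[OF compact_Icc _ assms] by fastforce
  have "integral {a..a+1} (\<lambda>_. \<phi> s) \<le> integral {a..a+1} \<phi>"
    using s assms by (intro integral_le integrable_continuous_interval) auto
  then show ?thesis using s by auto
qed

text \<open>All constants are fixed before \<open>T\<close> and \<open>u\<close> are introduced,
  which makes them independent of the horizon; the threshold for \<open>T\<close> is the steering
  time \<open>S\<close>.\<close>

lemma (in lipschitz_control_system) exponential_decay:
  assumes S: "0 < S" and ctrl: "controllable_with_local_cost f S ybar"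
  shows "\<exists>C>0. \<exists>\<mu>>0. \<forall>T>S. \<forall>u.
           is_arg_min (tracking_cost f ybar y0 T) (\<lambda>v. v \<in> L2 T) u \<longrightarrow>
             L2_norm T u \<le> C \<and>
             (\<forall>y. solves f T y0 u y \<longrightarrow>
                (\<forall>t\<in>{0..T}. norm (y t - ybar) \<le> C * exp (- \<mu> * t)))"
proof -
  obtain v0 z0 where v0: "v0 \<in> L2 S" "solves f S y0 v0 z0" "z0 S = ybar"
    using ctrl unfolding controllable_with_local_cost_def steering_controls_def by blast
  \<comment> \<open>Steering \<open>y0\<close> to \<open>ybar\<close> in time \<open>S\<close> and
    resting there bounds the optimal cost by \<open>K0\<close> for every \<open>T > S\<close>;
    adding \<open>1\<close> makes \<open>K0\<close> strictly positive.\<close>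
  define K0 where "K0 = integral {0..S} (running_cost ybar v0 z0) + 1"
  have K0: "0 < K0" unfolding K0_def by (intro add_nonneg_pos integral_nonneg) 
      (use running_cost_integrable[OF v0(2,1)] in auto)
  obtain r K where r: "0 < r" and K: "0 < K" and steer:
    "\<And>p. norm (p - ybar) \<le> r \<Longrightarrow> \<exists>v z. v \<in> L2 S \<and> solves f S p v z \<and> z S = ybar \<and>
       integral {0..S} (running_cost ybar v z) \<le> K * (norm (p - ybar))\<^sup>2"
    using local_steering[OF S ctrl] by blast
  obtain G where G: "0 < G" and bound: "\<And>T u y z0 s t q. \<lbrakk>u \<in> L2 T; solves f T z0 u y; 0 \<le> s; s \<le> t; t \<le> T; t - s \<le> 1;
       0 < q; q \<le> sqrt K0; integral {s..t} (\<lambda>r. (norm (u r))\<^sup>2) \<le> q\<^sup>2\<rbrakk>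
       \<Longrightarrow> norm (y t - ybar) \<le> G * (norm (y s - ybar) + q)"
    using deviation_bound[of 1 "sqrt K0"] by auto
  \<comment> \<open>The first term serves states within distance \<open>r\<close> of
    \<open>ybar\<close>, where cheap steering applies, the second those farther away, where the cost
    is still at most \<open>K0\<close>.\<close>
  define B where "B = max K (K0 / r\<^sup>2)"
  have B: "0 < B" unfolding B_def using K by simp
  \<comment> \<open>Solving \<open>g (a + 1) \<le> B * (g a - g (a + 1))\<close> for
    \<open>g (a + 1)\<close> gives this contraction factor per unit of time.\<close>
  define \<theta> where "\<theta> = B / (B + 1)"
  have \<theta>: "0 < \<theta>" "\<theta> < 1" unfolding \<theta>_def using B by auto
  \<comment> \<open>The cost is quadratic in the deviation, so the deviation decays at half the rate
    of the cost: \<open>\<theta> = exp (- 2 * \<mu>)\<close>.\<close>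
  define \<mu> where "\<mu> = - ln \<theta> / 2"
  have \<mu>: "0 < \<mu>" unfolding \<mu>_def using \<theta> by simp
  have \<theta>_exp: "\<theta> ^ n = (exp (- \<mu> * real n))\<^sup>2" for n
  proof -
    have "\<theta> = exp (- 2 * \<mu>)" unfolding \<mu>_def using \<theta> by simp
    then have "\<theta> ^ n = exp (real n * (- 2 * \<mu>))" by (simp only: exp_of_nat_mult)
    also have "\<dots> = (exp (- \<mu> * real n))\<^sup>2" by (simp add: exp_double[symmetric] algebra_simps)
    finally show ?thesis .
  qed
  define D where "D = 2 * G * (norm (y0 - ybar) + sqrt K0)"
  have D: "0 < D" unfolding D_def using G K0 by (intro mult_pos_pos add_nonneg_pos) auto
  \<comment> \<open>The factor \<open>exp (\<mu> * (2 + S))\<close> pays for the delay between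
    \<open>t\<close> and the integer time at which decay is used: one unit for the window before
    \<open>t\<close>, at most one for rounding, and \<open>S\<close> for the final stretch too short
    for steering. The summand \<open>sqrt K0\<close> covers the control norm.\<close>
  define C where "C = D * exp (\<mu> * (2 + S)) + sqrt K0"
  have C: "0 < C" unfolding C_def using D K0 by (intro add_pos_pos) auto
  have "L2_norm T u \<le> C \<and> (\<forall>y. solves f T y0 u y \<longrightarrow>
          (\<forall>t\<in>{0..T}. norm (y t - ybar) \<le> C * exp (- \<mu> * t)))"
    if T: "S < T" and min: "is_arg_min (tracking_cost f ybar y0 T) (\<lambda>v. v \<in> L2 T) u" for T u
  proof (intro conjI allI impI ballI)
    have u: "u \<in> L2 T" using min by (simp add: is_arg_min_def)
    obtain w where w: "w \<in> L2 T" "tracking_cost f ybar y0 T w =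
        integral {0..0} (running_cost ybar u (\<lambda>_. y0)) + integral {0..S} (running_cost ybar v0 z0)"
      using competitor[where y = "\<lambda>_. y0" and T = T, OF L2_mono[OF u] solves_zero_length order_refl v0] S T
      by auto
    have J: "tracking_cost f ybar y0 T u \<le> K0"
      using min w unfolding K0_def is_arg_min_def by fastforce
    have "L2_norm T u \<le> sqrt K0"
      using L2_norm_le_tracking_cost[of T u f ybar y0] J by (intro real_le_rsqrt) simp
    then show "L2_norm T u \<le> C"
      unfolding C_def using D by (intro order_trans[OF _ le_add_same_cancel2[THEN iffD2]]) auto
    fix y t assume y: "solves f T y0 u y" and t: "t \<in> {0..T}"
    let ?l = "running_cost ybar u y"
    define g where "g s = integral {s..T} ?l" for s
    have li: "?l integrable_on {s..s'}" if "0 \<le> s" "s' \<le> T" for s s'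
      using running_cost_integrable[OF y u that] .
    have split: "integral {a..b} ?l + g b = g a" if "0 \<le> a" "a \<le> b" "b \<le> T" for a b
      unfolding g_def using that li
      by (intro Henstock_Kurzweil_Integration.integral_combine) auto
    have int_nonneg: "0 \<le> integral {a..b} ?l" if "0 \<le> a" "b \<le> T" for a b
      using li[OF that] by (intro integral_nonneg) auto
    have anti: "g b \<le> g a" if "0 \<le> a" "a \<le> b" "b \<le> T" for a b
      using split[OF that] int_nonneg[of a b] that by simp
    have int_le: "integral {a..b} ?l \<le> g a" if "0 \<le> a" "a \<le> b" "b \<le> T" for a b
      using split[OF that] int_nonneg[of b T] that unfolding g_def by simp
    have g0: "g 0 \<le> K0" using J tracking_cost_eq[OF u y] unfolding g_def by simp
    have g_le: "g s \<le> B * (norm (y s - ybar))\<^sup>2" if s: "0 \<le> s" "s + S \<le> T" for s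
    proof (cases "norm (y s - ybar) \<le> r")
      case True
      then obtain v z where v: "v \<in> L2 S" "solves f S (y s) v z" "z S = ybar"
        and le: "integral {0..S} (running_cost ybar v z) \<le> K * (norm (y s - ybar))\<^sup>2"
        using steer by blast
      have "g s \<le> K * (norm (y s - ybar))\<^sup>2"
        using minimizer_tail_le[OF min y s v] S le unfolding g_def by simp
      also have "\<dots> \<le> B * (norm (y s - ybar))\<^sup>2"
        unfolding B_def by (intro mult_right_mono) auto
      finally show ?thesis .
    next
      case False
      \<comment> \<open>Outside the ball the deviation exceeds \<open>r\<close>, so
        \<open>K0\<close> is at most \<open>K0 / r^2\<close> times the squared deviation.\<close>
      have "g s \<le> K0" using anti[of 0 s] g0 s S by simp
      also have "\<dots> = K0 / r\<^sup>2 * r\<^sup>2" using r by simp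
      also have "\<dots> \<le> B * (norm (y s - ybar))\<^sup>2"
        unfolding B_def using False r K by (intro mult_mono power_mono) auto
      finally show ?thesis .
    qed
    have mean: "\<exists>s\<in>{a..a+1}. (norm (y s - ybar))\<^sup>2 \<le> integral {a..a+1} ?l"
      if a: "0 \<le> a" "a + 1 \<le> T" for a
    proof -
      have "continuous_on {a..a+1} (\<lambda>s. (norm (y s - ybar))\<^sup>2)"
        using y a unfolding solves_iff
        by (intro continuous_intros) (auto intro: continuous_on_subset)
      from exists_le_unit_integral[OF this] show ?thesis
        using deviation_le_running_cost[OF y u a, of ybar] by (meson order_trans)
    qed
    \<comment> \<open>The good time \<open>s\<close> may be as late as \<open>a + 1\<close>, and
      bounding \<open>g s\<close> needs a further time \<open>S\<close> for steering; hence
      \<open>a + 1 + S \<le> T\<close>.\<close>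
    have step: "g (a + 1) \<le> \<theta> * g a" if a: "0 \<le> a" "a + 1 + S \<le> T" for a
    proof -
      obtain s where s: "s \<in> {a..a+1}" "(norm (y s - ybar))\<^sup>2 \<le> integral {a..a+1} ?l"
        using mean[of a] a S by auto
      have "g (a + 1) \<le> g s" using s a S by (intro anti) auto
      also have "\<dots> \<le> B * (norm (y s - ybar))\<^sup>2" using s a by (intro g_le) auto
      also have "\<dots> \<le> B * integral {a..a+1} ?l" using s B by (intro mult_left_mono) auto
      also have "\<dots> = B * (g a - g (a + 1))" using split[of a "a + 1"] a S by simp
      finally show ?thesis unfolding \<theta>_def using B by (simp add: field_simps)
    qed
    have decay: "real n + S \<le> T \<Longrightarrow> g (real n) \<le> K0 * \<theta> ^ n" for n
    proof (induction n)
      case 0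
      then show ?case using g0 by simp
    next
      case (Suc n)
      have "g (real (Suc n)) \<le> \<theta> * g (real n)"
        using step[of "real n"] Suc.prems by (simp add: add.commute)
      also have "\<dots> \<le> \<theta> * (K0 * \<theta> ^ n)" using Suc \<theta> by (intro mult_left_mono) auto
      finally show ?case by (simp add: mult_ac)
    qed
    have "norm (y t - ybar) \<le> D * exp (\<mu> * (2 + S)) * exp (- \<mu> * t)"
    proof (cases "t < 1")
      \<comment> \<open>Before time \<open>1\<close> there is no full unit window to the left of
        \<open>t\<close>, so the estimate starts from \<open>y0\<close> with the uniform cost
        bound.\<close>
      case True
      have "integral {0..t} (\<lambda>r. (norm (u r))\<^sup>2) \<le> integral {0..t} ?l"
        using control_le_running_cost[OF y u] t by simp
      also have "\<dots> \<le> K0" using int_le[of 0 t] g0 t by simp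
      finally have "norm (y t - ybar) \<le> G * (norm (y 0 - ybar) + sqrt K0)"
        using True t K0 by (intro bound[OF u y]) auto
      also have "\<dots> \<le> D * 1"
        using solves_start[OF y] T S G K0 unfolding D_def by simp
      also have "\<dots> \<le> D * exp (\<mu> * (2 + S - t))"
        using D \<mu> S True by (intro mult_left_mono) auto
      finally show ?thesis by (simp add: mult.assoc exp_add[symmetric] algebra_simps)
    next
      case False
      \<comment> \<open>The last integer up to \<open>t - 1 - S\<close>, or \<open>0\<close> if that
        is negative: then \<open>n \<le> t - 1\<close>, and \<open>n + S \<le> T\<close> so that
        \<open>decay\<close> applies at \<open>n\<close>.\<close>
      define n where "n = nat \<lfloor>max 0 (t - 1 - S)\<rfloor>"
      have n: "real n \<le> max 0 (t - 1 - S)" "t - 2 - S \<le> real n"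
        unfolding n_def by linarith+
      have n': "real n \<le> t - 1" "real n + S \<le> T" using n(1) t T False S by auto
      \<comment> \<open>The square root of the decayed cost bound: \<open>q\<close> squared bounds
        both the control energy on \<open>{s..t}\<close> and the squared deviation at the time
        \<open>s\<close> chosen below, from which Gronwall reaches \<open>t\<close>.\<close>
      define q where "q = sqrt K0 * exp (- \<mu> * real n)"
      have q: "0 < q" "q \<le> sqrt K0" "q\<^sup>2 = K0 * \<theta> ^ n"
        unfolding q_def \<theta>_exp using K0 \<mu> by (auto simp: power_mult_distrib)
      have g_q: "g (t - 1) \<le> q\<^sup>2"
        using anti[of "real n" "t - 1"] decay[of n] n' q(3) t by simp
      obtain s where s: "s \<in> {t-1..t}" "(norm (y s - ybar))\<^sup>2 \<le> integral {t-1..t} ?l"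
        using mean[of "t - 1"] t False by auto
      have "(norm (y s - ybar))\<^sup>2 \<le> q\<^sup>2" using s int_le[of "t - 1" t] g_q t False by simp
      then have ys: "norm (y s - ybar) \<le> q" using q(1) by (simp add: power2_le_iff_abs_le)
      have "integral {s..t} (\<lambda>r. (norm (u r))\<^sup>2) \<le> integral {s..t} ?l"
        using control_le_running_cost[OF y u] t s False by simp
      also have "\<dots> \<le> g (t - 1)" using int_le[of s t] anti[of "t - 1" s] t s False by simp
      also note g_q
      finally have "norm (y t - ybar) \<le> G * (norm (y s - ybar) + q)"
        using s t False q by (intro bound[OF u y]) auto
      also have "\<dots> \<le> G * (q + q)" using ys G by (intro mult_left_mono) auto
      also have "\<dots> = 2 * G * sqrt K0 * exp (- \<mu> * real n)" by (simp add: q_def)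
      also have "\<dots> \<le> D * exp (\<mu> * (2 + S - t))"
      proof (intro mult_mono)
        show "2 * G * sqrt K0 \<le> D" unfolding D_def using G by simp
        have "\<mu> * (t - 2 - S) \<le> \<mu> * real n" using n(2) \<mu> by (intro mult_left_mono) auto
        then show "exp (- \<mu> * real n) \<le> exp (\<mu> * (2 + S - t))" by (simp add: algebra_simps)
      qed (use D in auto)
      finally show ?thesis by (simp add: mult.assoc exp_add[symmetric] algebra_simps)
    qed
    also have "\<dots> \<le> C * exp (- \<mu> * t)"
      unfolding C_def using K0 by (intro mult_right_mono) auto
    finally show "norm (y t - ybar) \<le> C * exp (- \<mu> * t)" .
  qed
  then show ?thesis using C \<mu> by blast
qed

section \<open>Control-affine systems with Lipschitz vector fields\<close>

lemma lipschitz_control_system_control_affine: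
  fixes f0 :: "real^'d \<Rightarrow> real^'d" and F :: "'m::finite \<Rightarrow> real^'d \<Rightarrow> real^'d"
  assumes "\<exists>L. L-lipschitz_on UNIV f0" and "\<And>j. \<exists>L. L-lipschitz_on UNIV (F j)"
    and "f0 ybar = 0"
  shows "\<exists>L M. lipschitz_control_system (control_affine f0 F) ybar L M"
proof -
  obtain L0 where L0: "L0-lipschitz_on UNIV f0" using assms(1) by blast
  obtain K where K: "\<And>j. (K j)-lipschitz_on UNIV (F j)" using assms(2) by metis
  have K0: "0 \<le> K j" for j using K lipschitz_on_nonneg by blast
  define L where "L = L0 + (\<Sum>j\<in>UNIV. K j)"
  define M where "M = (\<Sum>j\<in>UNIV. norm (F j ybar))"
  have L0_nonneg: "0 \<le> L0" using L0 lipschitz_on_nonneg by blast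
  have sK: "0 \<le> (\<Sum>j\<in>UNIV. K j)" using K0 by (intro sum_nonneg) auto
  have "lipschitz_control_system (control_affine f0 F) ybar L M"
  proof
    fix y z :: "real^'d" and u :: "real^'m"
    have 0: "norm (f0 y - f0 z) \<le> L0 * norm (y - z)"
      using lipschitz_onD[OF L0, of y z] by (simp add: dist_norm)
    \<comment> \<open>Each component of \<open>u\<close> is bounded by \<open>norm u\<close>, so the
      control fields contribute the Lipschitz constant \<open>norm u\<close> times the sum of the
      \<open>K j\<close>, which is the growth that the locale allows.\<close>
    have "norm (\<Sum>j\<in>UNIV. (u $ j) *\<^sub>R (F j y - F j z)) \<le> (\<Sum>j\<in>UNIV. norm u * (K j * norm (y - z)))"
    proof (rule sum_norm_le)
      fix j
      have "norm (F j y - F j z) \<le> K j * norm (y - z)"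
        using lipschitz_onD[OF K, of y z j] by (simp add: dist_norm)
      then show "norm ((u $ j) *\<^sub>R (F j y - F j z)) \<le> norm u * (K j * norm (y - z))"
        using component_le_norm_cart[of u j] by (auto intro: mult_mono)
    qed
    also have "\<dots> = (\<Sum>j\<in>UNIV. K j) * norm u * norm (y - z)"
      by (simp add: sum_distrib_left sum_distrib_right mult_ac)
    finally have 1: "norm (\<Sum>j\<in>UNIV. (u $ j) *\<^sub>R (F j y - F j z)) \<le> (\<Sum>j\<in>UNIV. K j) * norm u * norm (y - z)" .
    have "control_affine f0 F y u - control_affine f0 F z u
        = (f0 y - f0 z) + (\<Sum>j\<in>UNIV. (u $ j) *\<^sub>R (F j y - F j z))"
      by (simp add: control_affine_def sum_subtractf scaleR_diff_right)
    then have "norm (control_affine f0 F y u - control_affine f0 F z u)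
        \<le> L0 * norm (y - z) + (\<Sum>j\<in>UNIV. K j) * norm u * norm (y - z)"
      using norm_triangle_ineq[of "f0 y - f0 z" "\<Sum>j\<in>UNIV. (u $ j) *\<^sub>R (F j y - F j z)"] 0 1 by simp
    also have "\<dots> \<le> L * (1 + norm u) * norm (y - z)"
      unfolding L_def using sK L0_nonneg by (simp add: algebra_simps)
    finally show "norm (control_affine f0 F y u - control_affine f0 F z u) \<le> L * (1 + norm u) * norm (y - z)" .
  next
    fix u :: "real^'m"
    have "norm (\<Sum>j\<in>UNIV. (u $ j) *\<^sub>R F j ybar) \<le> (\<Sum>j\<in>UNIV. norm (F j ybar) * norm u)"
      using component_le_norm_cart[of u] by (intro sum_norm_le) (auto simp: mult.commute[of "norm (F _ _)"] intro: mult_right_mono)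
    then show "norm (control_affine f0 F ybar u) \<le> M * norm u"
      unfolding M_def control_affine_def using assms(3) by (simp add: sum_distrib_right)
  next
    show "0 \<le> L" unfolding L_def using sK L0_nonneg by simp
    show "0 \<le> M" unfolding M_def by (intro sum_nonneg) auto
  qed
  then show ?thesis by blast
qed

theorem corollary2p1:
  fixes f0 :: "real^'d \<Rightarrow> real^'d"
    and F :: "'m::finite \<Rightarrow> real^'d \<Rightarrow> real^'d"
    and f :: "real^'d \<Rightarrow> real^'m \<Rightarrow> real^'d"
    and ybar y0 :: "real^'d"
    and T0 :: real
  assumes f0_lipschitz: "\<exists>L. L-lipschitz_on UNIV f0"
    and F_lipschitz: "\<And>j. \<exists>L. L-lipschitz_on UNIV (F j)"
    and f_eq: "f = control_affine f0 F"
    and steady: "f0 ybar = 0"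
    and T0_pos: "T0 > 0"
    and controllable: "controllable_with_local_cost f T0 ybar"
  shows "\<exists>Tstar>0. \<exists>C>0. \<exists>\<mu>>0. \<forall>T>Tstar. \<forall>u.
           is_arg_min (tracking_cost f ybar y0 T) (\<lambda>v. v \<in> L2 T) u \<longrightarrow>
             L2_norm T u \<le> C \<and>
             (\<forall>y. solves f T y0 u y \<longrightarrow>
                (\<forall>t\<in>{0..T}. norm (y t - ybar) \<le> C * exp (- \<mu> * t)))"
proof -
  obtain L M where "lipschitz_control_system f ybar L M"
    using lipschitz_control_system_control_affine[where F = F, OF f0_lipschitz F_lipschitz steady] f_eq by auto
  \<comment> \<open>The steering time \<open>T0\<close> itself serves as
    \<open>Tstar\<close>.\<close>
  then show ?thesis
    using lipschitz_control_system.exponential_decay[OF _ T0_pos controllable, of L M y0] T0_pos by blast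
qed

end
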